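(* Let $M \geq 1$, let $\tau = (1, 2, \dots, M) \in \mathfrak{S}_M$ be an $M$-cycle, and let $\sigma$ be uniformly distributed in $\mathfrak{S}_M$. Then, as polynomials in $t$, $$\mathbb{E}\left( t^{\mathscr{C}([\sigma,\tau])} \right) = \frac{1}{(M+1)!}\left( F_{M+1}^+(t) - F_{M+1}^-(t) \right),$$ which is equivalent to the equality in distribution $$\mathscr{C}([\sigma,\tau]) \stackrel{d}{=} \mathscr{C}(\nu),$$ where $\nu$ is uniformly distributed on $\mathfrak{S}_{M+1} \setminus \mathfrak{A}_{M+1}$, the set of odd permutations of $M+1$ elements.
   Context: $\mathfrak{S}_n$ is the symmetric group on $\{1,\dots,n\}$ and $\mathfrak{A}_n$ is the alternating group. For a permutation $\pi$, $\mathscr{C}(\pi)$ denotes its number of cycles, fixed points being counted as cycles of length $1$. The commutator is $[\sigma,\tau] = \sigma\tau\sigma^{-1}\tau^{-1}$. The rising and falling factorial polynomials are $F_n^+(X) = X(X+1)\cdots(X+n-1)$ and $F_n^-(X) = X(X-1)\cdots(X-n+1)$, with $F_0^+ = F_0^- = 1$. *)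

theory Defs
  imports
    "HOL-Probability.Probability"
    "HOL-Algebra.Sym_Groups"
    "HOL-Combinatorics.Orbits"
    "HOL-Computational_Algebra.Polynomial"
begin

text \<open>
  A permutation of \<open>{1..n}\<close> is a function on all of \<open>nat\<close> that is the identity outside \<open>{1..n}\<close>,
  so the ground set is an explicit argument: without it every point outside \<open>{1..n}\<close> would count
  as a fixed point. A fixed point in the ground set contributes its singleton orbit.
\<close>

definition num_cycles :: "'a set \<Rightarrow> ('a \<Rightarrow> 'a) \<Rightarrow> nat" where
  "num_cycles A p = card (orbit p ` A)"

definition commutator :: "('a, 'b) monoid_scheme \<Rightarrow> 'a \<Rightarrow> 'a \<Rightarrow> 'a" where
  "commutator G x y = x \<otimes>\<^bsub>G\<^esub> y \<otimes>\<^bsub>G\<^esub> inv\<^bsub>G\<^esub> x \<otimes>\<^bsub>G\<^esub> inv\<^bsub>G\<^esub> y"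

definition rising_fact_poly :: "nat \<Rightarrow> real poly" where
  "rising_fact_poly n = (\<Prod>i<n. [:0, 1:] + of_nat i)"

definition falling_fact_poly :: "nat \<Rightarrow> real poly" where
  "falling_fact_poly n = (\<Prod>i<n. [:0, 1:] - of_nat i)"

text \<open>
  The type of real polynomials carries no norm, so the expectation of a polynomial-valued random
  variable is written out as a sum; it is meant for finitely supported distributions only. The
  lemma below relates it to the expectation of the evaluations.
\<close>

definition poly_expectation :: "'a pmf \<Rightarrow> ('a \<Rightarrow> real poly) \<Rightarrow> real poly" where
  "poly_expectation p X = (\<Sum>x\<in>set_pmf p. smult (pmf p x) (X x))"

lemma poly_poly_expectation:
  assumes "finite (set_pmf p)"
  shows "poly (poly_expectation p X) t = measure_pmf.expectation p (\<lambda>x. poly (X x) t)"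
  using assms by (simp add: poly_expectation_def poly_sum integral_measure_pmf[of "set_pmf p"])

end

theory Submission
  imports Defs
begin

text \<open>
  Put \<open>n = M + 1\<close>. The conjugate \<open>\<sigma>\<tau>\<sigma>\<^sup>-\<^sup>1\<close> of an \<open>M\<close>-cycle by a random permutation is a random \<open>M\<close>-cycle,
  so the commutator \<open>[\<sigma>, \<tau>]\<close> is the quotient of a random \<open>M\<close>-cycle by a fixed one. Inserting a new
  point into a cycle amounts to multiplying by a transposition, and an inserted transposition
  \<open>(a m)\<close> with \<open>m\<close> a new point does not change the number of cycles of a product
  (\<open>num_cycles_insert_transp\<close>). Hence the quotient of two \<open>M\<close>-cycles has as many cycles, in
  distribution, as the quotient of a random \<open>n\<close>-cycle by a random \<open>(n - 1)\<close>-cycle on \<open>n\<close> points.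
  Such a quotient is odd, and it is uniformly distributed on the odd permutations: every odd \<open>\<alpha>\<close>
  arises from exactly \<open>2 (n - 2)!\<close> pairs of a point \<open>f\<close> and a cycle \<open>c\<close> through all points but \<open>f\<close>
  such that \<open>\<alpha>c\<close> is an \<open>n\<close>-cycle (\<open>sum_cofactor_count_odd\<close>).

  This last fact is proved by induction on \<open>n\<close>. Choose a point \<open>m\<close> moved by \<open>\<alpha>\<close>, let \<open>p\<close> be its
  preimage, and write \<open>\<alpha> = \<beta> (p m)\<close> with \<open>\<beta>\<close> fixing \<open>m\<close>. Deleting \<open>m\<close> from a cycle missing some
  \<open>f\<close> other than \<open>m\<close> and \<open>p\<close> leads to \<open>\<beta> (p a)\<close>, where \<open>a\<close> is the point that followed \<open>m\<close>. The cycles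
  missing \<open>m\<close> and those missing \<open>p\<close> correspond to the full cycles \<open>d\<close> on the other \<open>n - 1\<close>
  points for which \<open>\<beta>d\<close> is a full cycle; deleting from \<open>d\<close> either \<open>p\<close> or the point before \<open>p\<close>
  turns them into the pairs of \<open>\<beta> (p a)\<close> missing \<open>p\<close> or \<open>a\<close>. Altogether the count for \<open>\<alpha>\<close> is
  the sum of the counts for the \<open>n - 2\<close> odd permutations \<open>\<beta> (p a)\<close> of \<open>n - 1\<close> points
  (\<open>sum_cofactor_count_insert\<close>).

  For the polynomial, inserting a point multiplies the generating function of the number of
  cycles by \<open>t + k\<close>, where \<open>k\<close> is the number of points so far, and its signed version by \<open>t - k\<close>.
  The two are therefore the rising and the falling factorial, and their difference counts each odd
  permutation twice (\<open>odd_cycle_generating_function\<close>).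
\<close>

section \<open>Orbits of a permutation under conjugation and insertion of a point\<close>

abbreviation transp :: "'a \<Rightarrow> 'a \<Rightarrow> 'a \<Rightarrow> 'a"
  where "transp \<equiv> Transposition.transpose"

definition long_cycles :: "'a set \<Rightarrow> ('a \<Rightarrow> 'a) set" where
  "long_cycles S = {p. p permutes S \<and> num_cycles S p = 1}"

lemma self_in_orbit_permutes:
  assumes "finite S" "p permutes S"
  shows "x \<in> orbit p x"
  by (rule permutation_self_in_orbit[OF permutes_imp_permutation[OF assms]])

lemma orbit_conjugate:
  assumes "bij t"
  shows "orbit (t \<circ> p \<circ> inv' t) (t x) = t ` orbit p x"
proof -
  have inv_t: "inv' t (t y) = y" for y
    using assms by (simp add: bij_is_inj)
  have "y \<in> orbit p x \<Longrightarrow> t y \<in> orbit (t \<circ> p \<circ> inv' t) (t x)" for y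
  proof (induct rule: orbit.induct)
    case base
    show ?case using orbit.base[of "t \<circ> p \<circ> inv' t" "t x"] by (simp add: inv_t comp_def)
  next
    case (step y)
    then show ?case using orbit.step[of "t y" "t \<circ> p \<circ> inv' t" "t x"] by (simp add: inv_t comp_def)
  qed
  moreover have "y \<in> orbit (t \<circ> p \<circ> inv' t) (t x) \<Longrightarrow> y \<in> t ` orbit p x" for y
    by (induct rule: orbit.induct) (auto simp: inv_t intro: orbit.intros)
  ultimately show ?thesis by blast
qed

lemma num_cycles_conjugate:
  assumes "bij t"
  shows "num_cycles (t ` S) (t \<circ> p \<circ> inv' t) = num_cycles S p"
proof -
  have "orbit (t \<circ> p \<circ> inv' t) ` (t ` S) = (`) t ` (orbit p ` S)"
    unfolding image_image orbit_conjugate[OF assms] by (rule refl)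
  moreover have "inj_on ((`) t) (orbit p ` S)"
    by (simp add: inj_on_def inj_image_eq_iff[OF bij_is_inj[OF assms]])
  ultimately show ?thesis
    unfolding num_cycles_def by (simp add: card_image)
qed

lemma permutes_conjugate:
  assumes "bij t" "p permutes S"
  shows "t \<circ> p \<circ> inv' t permutes t ` S"
proof (rule bij_imp_permutes)
  have "bij_betw (inv' t) (t ` S) S"
    using assms(1) by (metis bij_betw_def bij_is_inj bij_imp_bij_inv image_inv_f_f inj_on_subset subset_UNIV)
  moreover have "bij_betw t S (t ` S)"
    using assms(1) by (meson bij_betw_def bij_is_inj inj_on_subset subset_UNIV)
  ultimately show "bij_betw (t \<circ> p \<circ> inv' t) (t ` S) (t ` S)"
    using permutes_imp_bij[OF assms(2)] by (meson bij_betw_trans)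
next
  fix x assume "x \<notin> t ` S"
  then have "inv' t x \<notin> S"
    using assms(1) by (metis bij_inv_eq_iff image_eqI)
  then have "p (inv' t x) = inv' t x"
    using assms(2) permutes_not_in by metis
  then show "(t \<circ> p \<circ> inv' t) x = x"
    using assms(1) by (simp add: bij_is_surj surj_f_inv_f)
qed

lemma long_cycles_conjugate:
  assumes "bij t" "p \<in> long_cycles S"
  shows "t \<circ> p \<circ> inv' t \<in> long_cycles (t ` S)"
  using assms permutes_conjugate[OF assms(1)] num_cycles_conjugate[OF assms(1)]
  unfolding long_cycles_def by auto

lemma num_cycles_comp_commute:
  assumes "p permutes S" "q permutes S"
  shows "num_cycles S (p \<circ> q) = num_cycles S (q \<circ> p)"
proof -
  have "p \<circ> (q \<circ> p) \<circ> inv' p = p \<circ> q"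
    by (simp add: fun_eq_iff permutes_inverses[OF assms(1)])
  then show ?thesis
    using num_cycles_conjugate[OF permutes_bij[OF assms(1)], of S "q \<circ> p"]
    by (simp add: permutes_image[OF assms(1)])
qed

text \<open>
  The orbits of \<open>p \<circ> transp a m\<close> are those of \<open>p\<close>, except that \<open>m\<close> is inserted right after \<open>a\<close> in
  the cycle of \<open>a\<close>. Intersecting with \<open>S\<close> therefore maps the new orbits bijectively to the old ones.
\<close>

lemma num_cycles_comp_transp:
  assumes "finite S" "p permutes S" "m \<notin> S" "a \<in> S"
  shows "num_cycles (insert m S) (p \<circ> transp a m) = num_cycles S p"
proof -
  let ?q = "p \<circ> transp a m"
  have pm: "p m = m"
    using assms permutes_not_in by metis
  have am: "a \<noteq> m" using assms by auto
  have self_p: "x \<in> orbit p x" for x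
    using self_in_orbit_permutes assms by metis
  have q: "?q permutes insert m S"
    using assms permutes_compose[of "transp a m" "insert m S" p]
    by (simp add: permutes_swap_id permutes_imp_permutes_insert)
  have self_q: "x \<in> orbit ?q x" for x
    using self_in_orbit_permutes[OF _ q] assms by simp
  have q_apply: "?q x = (if x = a then m else if x = m then p a else p x)" for x
    using pm by (simp add: Transposition.transpose_def)
  have p_in: "p x \<in> S" if "x \<in> S" for x
    using permutes_in_image[OF assms(2)] that by simp
  have 1: "(y \<in> S \<longrightarrow> y \<in> orbit p x) \<and> (y = m \<longrightarrow> a \<in> orbit p x)"
    if "x \<in> S" "y \<in> orbit ?q x" for x y
    using that(2)
  proof induct
    case base
    have "x \<noteq> m" using that(1) assms(3) by blast
    then show ?case
      using self_p[of a] orbit.base[of p x] assms(3) p_in[OF that(1)]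
      unfolding q_apply by auto
  next
    case (step y)
    have "y \<in> insert m S"
      using permutes_orbit_subset[OF q, of x] that(1) step(1) by blast
    then show ?case
      using step(2) assms(3) orbit.step[of y p x] orbit.step[of a p x] p_in[of y] p_in[OF assms(4)]
      unfolding q_apply by auto
  qed
  have double: "?q (?q a) = p a" using am pm by simp
  have 2: "y \<in> orbit ?q x" if "x \<in> S" "y \<in> orbit p x" for x y
    using that(2)
  proof induct
    case base
    have "x \<noteq> m" using that(1) assms(3) by blast
    then have "p x = (if x = a then ?q (?q x) else ?q x)"
      using double by simp
    then show ?case
      using orbit.base[of ?q x] orbit.step[OF orbit.base[of ?q x]] by (auto simp only: split: if_splits)
  next
    case (step y)
    have "y \<in> S"
      using permutes_orbit_subset[OF assms(2) that(1)] step(1) by blast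
    then have "y \<noteq> m" using assms(3) by blast
    then have "p y = (if y = a then ?q (?q y) else ?q y)"
      using double by simp
    then show ?case
      using orbit.step[OF step(2)] orbit.step[OF orbit.step[OF step(2)]]
      by (auto simp only: split: if_splits)
  qed
  have inter: "orbit ?q x \<inter> S = orbit p x" if "x \<in> S" for x
    using 1[OF that] 2[OF that] permutes_orbit_subset[OF assms(2) that] by blast
  have "?q a = m" using pm by simp
  then have "orbit ?q m = orbit ?q a"
    using self_in_orbit_step[OF self_q, of a] by simp
  then have "orbit ?q ` insert m S = orbit ?q ` S"
    using assms(4) by auto
  moreover have "orbit p ` S = (\<lambda>X. X \<inter> S) ` (orbit ?q ` S)"
    unfolding image_image by (rule image_cong) (simp_all add: inter)
  moreover have "inj_on (\<lambda>X. X \<inter> S) (orbit ?q ` S)"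
  proof (rule inj_onI, clarify)
    fix x y assume xy: "x \<in> S" "y \<in> S" "orbit ?q x \<inter> S = orbit ?q y \<inter> S"
    then have "x \<in> orbit ?q y" using self_q[of x] by blast
    then show "orbit ?q x = orbit ?q y"
      using self_q by (metis orbit_cyclic_eq3 cyclic_on_orbit q assms(1) finite_insert)
  qed
  ultimately show ?thesis
    unfolding num_cycles_def by (metis card_image)
qed

text \<open>
  The transposition may sit anywhere in a product: up to conjugation on \<open>insert m S\<close> the product
  is cyclically symmetric, so the factor \<open>p\<close> or \<open>q\<close> can be moved to the other side. This invariance
  is what transports statements about \<open>n\<close> points to statements about \<open>n - 1\<close> points.
\<close>

lemma num_cycles_insert_transp:
  assumes "finite S" "p permutes S" "q permutes S" "m \<notin> S" "a \<in> S"
  shows "num_cycles (insert m S) (p \<circ> transp a m \<circ> q) = num_cycles S (p \<circ> q)"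
proof -
  have p: "p permutes insert m S" and q: "q permutes insert m S"
    using assms permutes_imp_permutes_insert by metis+
  have t: "transp a m permutes insert m S"
    using assms by (simp add: permutes_swap_id)
  have "num_cycles (insert m S) (p \<circ> transp a m \<circ> q)
      = num_cycles (insert m S) (q \<circ> (p \<circ> transp a m))"
    by (rule num_cycles_comp_commute[OF permutes_compose[OF t p] q])
  also have "\<dots> = num_cycles (insert m S) ((q \<circ> p) \<circ> transp a m)"
    by (simp add: comp_assoc)
  also have "\<dots> = num_cycles S (q \<circ> p)"
    using assms by (intro num_cycles_comp_transp permutes_compose)
  also have "\<dots> = num_cycles S (p \<circ> q)"
    by (rule num_cycles_comp_commute[OF assms(3,2)])
  finally show ?thesis .
qed

lemma num_cycles_insert_fixed:
  assumes "finite S" "p permutes S" "m \<notin> S"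
  shows "num_cycles (insert m S) p = Suc (num_cycles S p)"
proof -
  have "p m = m"
    using assms permutes_not_in by metis
  then have "orbit p m = {m}" by (simp add: orbit_eq_singleton_iff)
  moreover have "{m} \<notin> orbit p ` S"
    using permutes_orbit_subset[OF assms(2)] assms(3) by blast
  ultimately show ?thesis
    unfolding num_cycles_def using assms(1) by simp
qed

lemma long_cycles_insert_transp_iff:
  assumes "finite S" "p permutes S" "q permutes S" "m \<notin> S" "a \<in> S"
  shows "p \<circ> transp a m \<circ> q \<in> long_cycles (insert m S) \<longleftrightarrow> p \<circ> q \<in> long_cycles S"
proof -
  have "p \<circ> transp a m \<circ> q permutes insert m S"
    using assms by (intro permutes_compose permutes_swap_id)
      (auto intro: permutes_imp_permutes_insert)
  then show ?thesis
    using num_cycles_insert_transp[OF assms] permutes_compose[OF assms(3,2)]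
    by (simp add: long_cycles_def)
qed

section \<open>Permutations with a single orbit\<close>

lemma orbit_long_cycle:
  assumes "finite S" "p \<in> long_cycles S" "x \<in> S"
  shows "orbit p x = S"
proof -
  have p: "p permutes S" and "card (orbit p ` S) = 1"
    using assms by (auto simp: long_cycles_def num_cycles_def)
  then obtain A where A: "orbit p ` S = {A}"
    by (auto simp: card_1_singleton_iff)
  have "orbit p y = orbit p x" if "y \<in> S" for y
    using A that assms(3) by blast
  then have "y \<in> orbit p x" if "y \<in> S" for y
    using self_in_orbit_permutes[OF assms(1) p] that by metis
  then show ?thesis
    using permutes_orbit_subset[OF p assms(3)] by blast
qed

lemma long_cycle_moves:
  assumes "finite S" "p \<in> long_cycles S" "x \<in> S" "S - {x} \<noteq> {}"
  shows "p x \<noteq> x"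
proof
  assume "p x = x"
  then have "orbit p x = {x}" by (simp add: orbit_eq_singleton_iff)
  then have "S = {x}" using orbit_long_cycle[OF assms(1-3)] by simp
  with assms(4) show False by simp
qed

lemma finite_long_cycles: "finite S \<Longrightarrow> finite (long_cycles S)"
  by (rule finite_subset[OF _ finite_permutations[of S]]) (simp add: long_cycles_def Collect_mono)

text \<open>
  A long cycle sending \<open>x\<close> to \<open>y\<close> is determined by the shorter cycle in which \<open>x\<close> is skipped. Since
  one of \<open>x\<close> and \<open>y\<close> can be fixed while the other varies, there are two ways to delete a point from
  all long cycles at once: \<open>sum_long_cycles_by_image\<close> always deletes the same point \<open>x\<close>, while
  \<open>sum_long_cycles_by_preimage\<close> deletes whichever point precedes \<open>y\<close>. The induction for odd
  permutations below needs both.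
\<close>

lemma bij_betw_long_cycles_delete:
  assumes "finite S" "x \<in> S" "y \<in> S" "x \<noteq> y"
  shows "bij_betw ((\<circ>) (transp x y)) (long_cycles (S - {x})) {d \<in> long_cycles S. d x = y}"
proof (rule bij_betw_byWitness[where f' = "(\<circ>) (transp x y)"])
  let ?T = "S - {x}"
  have S: "insert x ?T = S" using assms by auto
  have T: "finite ?T" "x \<notin> ?T" "y \<in> ?T" using assms by auto
  have iff: "transp x y \<circ> g \<in> long_cycles S \<longleftrightarrow> g \<in> long_cycles ?T" if "g permutes ?T" for g
    using long_cycles_insert_transp_iff[OF T(1) permutes_id that T(2,3)]
    unfolding S by (simp add: transpose_commute)
  show "\<forall>g\<in>long_cycles ?T. transp x y \<circ> (transp x y \<circ> g) = g"
    and "\<forall>d\<in>{d \<in> long_cycles S. d x = y}. transp x y \<circ> (transp x y \<circ> d) = d"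
    by (simp_all add: fun_eq_iff)
  show "(\<circ>) (transp x y) ` long_cycles ?T \<subseteq> {d \<in> long_cycles S. d x = y}"
  proof clarify
    fix g assume g: "g \<in> long_cycles ?T"
    then have p: "g permutes ?T" by (simp add: long_cycles_def)
    then have "g x = x" using T(2) permutes_not_in by metis
    with g iff[OF p] show "transp x y \<circ> g \<in> long_cycles S \<and> (transp x y \<circ> g) x = y" by simp
  qed
  show "(\<circ>) (transp x y) ` {d \<in> long_cycles S. d x = y} \<subseteq> long_cycles ?T"
  proof (rule image_subsetI)
    fix d assume "d \<in> {d \<in> long_cycles S. d x = y}"
    then have d: "d \<in> long_cycles S" "d x = y" by simp_all
    then have "d permutes insert x ?T" unfolding S by (simp add: long_cycles_def)
    from permutes_insert_lemma[OF this] have p: "transp x y \<circ> d permutes ?T"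
      unfolding d(2) .
    have "transp x y \<circ> (transp x y \<circ> d) = d" by (simp add: fun_eq_iff)
    with iff[OF p] d(1) show "transp x y \<circ> d \<in> long_cycles ?T" by metis
  qed
qed

lemma long_cycle_deleteE:
  assumes "finite S" "d \<in> long_cycles S" "x \<in> S" "S - {x} \<noteq> {}"
  obtains y c where "y \<in> S - {x}" "c \<in> long_cycles (S - {x})" "d = transp x y \<circ> c"
proof -
  have "d x \<in> S" using assms(2,3) permutes_in_image[of d S x] by (simp add: long_cycles_def)
  moreover have "d x \<noteq> x" by (rule long_cycle_moves[OF assms])
  ultimately have "d \<in> (\<circ>) (transp x (d x)) ` long_cycles (S - {x})"
    using bij_betw_imp_surj_on[OF bij_betw_long_cycles_delete[of S x "d x"]] assms by simp
  with \<open>d x \<in> S\<close> \<open>d x \<noteq> x\<close> show thesis by (auto intro: that)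
qed

lemma sum_long_cycles_at:
  assumes "finite S" "x \<in> S" "y \<in> S" "x \<noteq> y"
  shows "(\<Sum>d \<in> {d \<in> long_cycles S. d x = y}. g d)
       = (\<Sum>c \<in> long_cycles (S - {x}). g (transp x y \<circ> c))"
  using sum.reindex_bij_betw[OF bij_betw_long_cycles_delete[OF assms], of g] by simp

lemma sum_long_cycles_by_image:
  assumes "finite S" "x \<in> S" "S - {x} \<noteq> {}"
  shows "(\<Sum>d \<in> long_cycles S. g d)
       = (\<Sum>y \<in> S - {x}. \<Sum>c \<in> long_cycles (S - {x}). g (transp x y \<circ> c))"
proof -
  have "d x \<in> S - {x}" if "d \<in> long_cycles S" for d
  proof -
    have "d x \<in> S" using that assms(2) permutes_in_image[of d S x] by (simp add: long_cycles_def)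
    then show ?thesis using long_cycle_moves[OF assms(1) that assms(2,3)] by simp
  qed
  then have "(\<Sum>d \<in> long_cycles S. g d) = (\<Sum>y \<in> S - {x}. \<Sum>d \<in> {d \<in> long_cycles S. d x = y}. g d)"
    using assms finite_long_cycles[OF assms(1)] by (subst sum.group) auto
  also have "\<dots> = (\<Sum>y \<in> S - {x}. \<Sum>c \<in> long_cycles (S - {x}). g (transp x y \<circ> c))"
    using assms by (intro sum.cong sum_long_cycles_at) auto
  finally show ?thesis .
qed

lemma sum_long_cycles_by_preimage:
  assumes "finite S" "y \<in> S" "S - {y} \<noteq> {}"
  shows "(\<Sum>d \<in> long_cycles S. g d)
       = (\<Sum>x \<in> S - {y}. \<Sum>c \<in> long_cycles (S - {x}). g (transp x y \<circ> c))"
proof -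
  have "inv' d y \<in> S - {y}" if "d \<in> long_cycles S" for d
  proof -
    have d: "d permutes S" using that by (simp add: long_cycles_def)
    then have "inv' d y \<in> S" using assms(2) permutes_in_image[OF permutes_inv] by metis
    moreover have "inv' d y \<noteq> y"
      using long_cycle_moves[OF assms(1) that assms(2,3)] permutes_inv_eq[OF d] by metis
    ultimately show ?thesis by simp
  qed
  then have "(\<Sum>d \<in> long_cycles S. g d)
      = (\<Sum>x \<in> S - {y}. \<Sum>d \<in> {d \<in> long_cycles S. inv' d y = x}. g d)"
    using assms finite_long_cycles[OF assms(1)] by (subst sum.group) auto
  also have "\<dots> = (\<Sum>x \<in> S - {y}. \<Sum>d \<in> {d \<in> long_cycles S. d x = y}. g d)"
    by (intro sum.cong refl) (auto simp: long_cycles_def permutes_inv_eq permutes_inverses)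
  also have "\<dots> = (\<Sum>x \<in> S - {y}. \<Sum>c \<in> long_cycles (S - {x}). g (transp x y \<circ> c))"
    using assms by (intro sum.cong sum_long_cycles_at) auto
  finally show ?thesis .
qed

lemma long_cycles_singleton: "long_cycles {x} = {id}"
  by (auto simp: long_cycles_def num_cycles_def)

lemma card_long_cycles:
  assumes "finite S" "S \<noteq> {}"
  shows "card (long_cycles S) = fact (card S - 1)"
  using assms
proof (induction S rule: finite_ne_induct)
  case (singleton x)
  then show ?case by (simp add: long_cycles_singleton)
next
  case (insert x S)
  have "card (long_cycles (insert x S)) = (\<Sum>d \<in> long_cycles (insert x S). 1)"
    by simp
  also have "\<dots> = (\<Sum>y \<in> S. \<Sum>c \<in> long_cycles S. 1)"
    using insert by (subst sum_long_cycles_by_image[where x = x]) auto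
  also have "\<dots> = card S * fact (card S - 1)"
    using insert by simp
  also have "\<dots> = fact (card S)"
    using insert by (metis card_gt_0_iff fact_reduce of_nat_id)
  finally show ?case using insert by simp
qed

lemma evenperm_long_cycle:
  assumes "finite S" "p \<in> long_cycles S"
  shows "evenperm p \<longleftrightarrow> odd (card S)"
proof -
  have "S \<noteq> {}" using assms by (auto simp: long_cycles_def num_cycles_def)
  with assms(1) show ?thesis using assms(2)
  proof (induction S arbitrary: p rule: finite_ne_induct)
    case (singleton x)
    then show ?case by (simp add: long_cycles_singleton)
  next
    case (insert x S)
    have del: "insert x S - {x} = S" using insert by auto
    obtain y c where y: "y \<in> S" and c: "c \<in> long_cycles S" "p = transp x y \<circ> c"
      using long_cycle_deleteE[OF _ insert.prems, of x] insert.hyps unfolding del by auto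
    have "x \<noteq> y" using y insert.hyps by auto
    have "permutation c"
      using c(1) insert(1) by (auto simp: long_cycles_def permutation_permutes)
    then have "evenperm p \<longleftrightarrow> \<not> evenperm c"
      using \<open>x \<noteq> y\<close> by (subst c(2)) (auto simp: evenperm_comp permutation_swap_id evenperm_swap)
    then show ?case using insert.IH[OF c(1)] insert.hyps by simp
  qed
qed

section \<open>Factorizations of an odd permutation into two cycles of consecutive lengths\<close>

text \<open>
  The cofactors of \<open>\<alpha>\<close> missing \<open>f\<close> are the cycles \<open>c\<close> through all points except \<open>f\<close> for which \<open>\<alpha> \<circ> c\<close>
  runs through all points; they are the factorizations of \<open>\<alpha>\<close> into a full cycle and the inverse
  of a cycle with fixed point \<open>f\<close>. The point \<open>f\<close> is an argument because on two points the
  cycle \<open>c\<close> is the identity and does not determine it.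
\<close>

definition cofactor_count :: "'a set \<Rightarrow> ('a \<Rightarrow> 'a) \<Rightarrow> 'a \<Rightarrow> nat" where
  "cofactor_count S \<alpha> f = card {c \<in> long_cycles (S - {f}). \<alpha> \<circ> c \<in> long_cycles S}"

lemma card_Collect_mem_conv_sum:
  "finite A \<Longrightarrow> card {x \<in> A. P x} = (\<Sum>x\<in>A. of_bool (P x) :: nat)"
  by (simp add: of_bool_def sum.inter_filter[symmetric])

lemma cofactor_count_conv_sum:
  "finite S \<Longrightarrow> cofactor_count S \<alpha> f = (\<Sum>c\<in>long_cycles (S - {f}). of_bool (\<alpha> \<circ> c \<in> long_cycles S))"
  unfolding cofactor_count_def by (intro card_Collect_mem_conv_sum finite_long_cycles) simp

text \<open>
  Both sums count the full cycles \<open>d\<close> for which \<open>\<beta> \<circ> d\<close> is a full cycle too: the first sorts them by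
  \<open>a = d p\<close> and deletes \<open>p\<close>, the second sorts them by the point \<open>a\<close> with \<open>d a = p\<close> and deletes \<open>a\<close>.
\<close>

lemma card_equal_size_cofactors:
  assumes "finite S" "p \<in> S" "S - {p} \<noteq> {}"
  shows "card {d \<in> long_cycles S. \<beta> \<circ> d \<in> long_cycles S}
       = (\<Sum>a\<in>S - {p}. cofactor_count S (\<beta> \<circ> transp p a) p)" (is "?B = _")
    and "card {d \<in> long_cycles S. \<beta> \<circ> d \<in> long_cycles S}
       = (\<Sum>a\<in>S - {p}. cofactor_count S (\<beta> \<circ> transp p a) a)"
proof -
  have B: "?B = (\<Sum>d\<in>long_cycles S. of_bool (\<beta> \<circ> d \<in> long_cycles S))"
    using assms by (intro card_Collect_mem_conv_sum finite_long_cycles)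
  show "?B = (\<Sum>a\<in>S - {p}. cofactor_count S (\<beta> \<circ> transp p a) p)"
    unfolding B sum_long_cycles_by_image[OF assms] cofactor_count_conv_sum[OF assms(1)] comp_assoc
    by (rule refl)
  show "?B = (\<Sum>a\<in>S - {p}. cofactor_count S (\<beta> \<circ> transp p a) a)"
    unfolding B sum_long_cycles_by_preimage[OF assms] cofactor_count_conv_sum[OF assms(1)] comp_assoc
    by (simp only: transpose_commute)
qed

text \<open>
  In the following, \<open>\<beta> \<circ> transp p m\<close> is a permutation of \<open>insert m S\<close> that moves the new point \<open>m\<close>,
  with \<open>p\<close> the preimage of \<open>m\<close>. Every permutation moving \<open>m\<close> has this form, so its cofactors can
  be counted in terms of permutations of \<open>S\<close>.
\<close>

context
  fixes S :: "'a set" and m p :: 'a and \<beta> :: "'a \<Rightarrow> 'a"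
  assumes fin: "finite S" and m: "m \<notin> S" and p: "p \<in> S" and \<beta>: "\<beta> permutes S"
begin

lemma cofactor_count_insert_at_new:
  "cofactor_count (insert m S) (\<beta> \<circ> transp p m) m
     = card {d \<in> long_cycles S. \<beta> \<circ> d \<in> long_cycles S}"
proof -
  have "\<beta> \<circ> transp p m \<circ> c \<in> long_cycles (insert m S) \<longleftrightarrow> \<beta> \<circ> c \<in> long_cycles S"
    if "c \<in> long_cycles S" for c
    using that by (intro long_cycles_insert_transp_iff[OF fin \<beta> _ m p]) (simp add: long_cycles_def)
  moreover have "insert m S - {m} = S" using m by auto
  ultimately show ?thesis
    unfolding cofactor_count_def by (metis (no_types, lifting))
qed

text \<open>
  Conjugation by \<open>transp p m\<close> exchanges the roles of \<open>m\<close> and \<open>p\<close>, which makes the cofactors missing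
  \<open>p\<close> as numerous as those missing \<open>m\<close>.
\<close>

lemma cofactor_count_insert_at_preimage:
  "cofactor_count (insert m S) (\<beta> \<circ> transp p m) p
     = card {d \<in> long_cycles S. \<beta> \<circ> d \<in> long_cycles S}"
proof -
  let ?t = "transp p m"
  let ?conj = "\<lambda>c. ?t \<circ> c \<circ> ?t"
  let ?S' = "insert m S - {p}"
  have S': "?t ` S = ?S'" "?t ` ?S' = S"
    using m p by (auto simp: in_transpose_image_iff Transposition.transpose_def image_iff)
  have conj: "?conj c \<in> long_cycles (?t ` A)" if "c \<in> long_cycles A" for A c
    using long_cycles_conjugate[OF bij_transpose that, of p m] by simp
  have "\<beta> \<circ> ?t \<circ> ?conj c \<in> long_cycles (insert m S) \<longleftrightarrow> \<beta> \<circ> c \<in> long_cycles S"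
    if "c permutes S" for c
  proof -
    have "\<beta> \<circ> ?t \<circ> ?conj c = \<beta> \<circ> c \<circ> ?t \<circ> id" by (simp add: fun_eq_iff)
    then show ?thesis
      using long_cycles_insert_transp_iff[OF fin permutes_compose[OF that \<beta>] permutes_id m p] by simp
  qed
  moreover have "?conj (?conj c) = c" for c by (simp add: fun_eq_iff)
  ultimately have "bij_betw ?conj {c \<in> long_cycles S. \<beta> \<circ> c \<in> long_cycles S}
      {c \<in> long_cycles ?S'. \<beta> \<circ> ?t \<circ> c \<in> long_cycles (insert m S)}"
    using conj[where A = S] conj[where A = ?S'] unfolding S'
    by (intro bij_betw_byWitness[where f' = ?conj] ballI image_subsetI)
      (simp_all add: long_cycles_def, metis)
  then show ?thesis
    unfolding cofactor_count_def by (simp add: bij_betw_same_card)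
qed

text \<open>
  A cofactor missing \<open>f\<close> passes through \<open>m\<close>; delete \<open>m\<close> from it and call \<open>a\<close> the point after \<open>m\<close>.
  The product of the two transpositions \<open>(p m)(m a)\<close> is \<open>(p a)(p m)\<close>, and the trailing \<open>(p m)\<close> only
  inserts \<open>m\<close>, so what remains is a cofactor of \<open>\<beta> \<circ> transp p a\<close>.
\<close>

lemma cofactor_count_insert_elsewhere:
  assumes "f \<in> S - {p}"
  shows "cofactor_count (insert m S) (\<beta> \<circ> transp p m) f
     = (\<Sum>a\<in>S - {f, p}. cofactor_count S (\<beta> \<circ> transp p a) f)"
proof -
  let ?C = "long_cycles (S - {f})"
  let ?T = "insert m S"
  have m': "m \<in> ?T - {f}" and del: "?T - {f} - {m} = S - {f}" and ne: "S - {f} \<noteq> {}"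
    using assms m p by auto
  have perm: "c permutes S" if "c \<in> ?C" for c
    using that permutes_subset[of c "S - {f}" S] by (auto simp: long_cycles_def)
  \<comment> \<open>If \<open>m\<close> is followed by \<open>p\<close>, the two transpositions cancel and the product fixes \<open>m\<close>.\<close>
  have same: "\<beta> \<circ> transp p m \<circ> (transp m p \<circ> c) \<notin> long_cycles ?T" if "c \<in> ?C" for c
  proof
    assume long: "\<beta> \<circ> transp p m \<circ> (transp m p \<circ> c) \<in> long_cycles ?T"
    have "c m = m" "\<beta> m = m"
      using perm[OF that] \<beta> m permutes_not_in by metis+
    then have "(\<beta> \<circ> transp p m \<circ> (transp m p \<circ> c)) m = m" by simp
    moreover have "?T - {m} \<noteq> {}" using m p by auto
    ultimately show False using long_cycle_moves[OF _ long, of m] fin by simp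
  qed
  have other: "\<beta> \<circ> transp p m \<circ> (transp m a \<circ> c) \<in> long_cycles ?T
      \<longleftrightarrow> \<beta> \<circ> transp p a \<circ> c \<in> long_cycles S" if "c \<in> ?C" "a \<in> S - {p}" for a c
  proof -
    have "m \<noteq> a" "m \<noteq> p" "a \<noteq> p" using that m p by auto
    then have "transp p m \<circ> transp m a = transp p a \<circ> transp p m"
      by (auto simp: fun_eq_iff Transposition.transpose_def)
    then have "\<beta> \<circ> transp p m \<circ> (transp m a \<circ> c) = \<beta> \<circ> transp p a \<circ> transp p m \<circ> c"
      by (metis comp_assoc)
    moreover have "\<beta> \<circ> transp p a permutes S"
      using that p \<beta> by (intro permutes_compose permutes_swap_id) auto
    ultimately show ?thesis
      using long_cycles_insert_transp_iff[OF fin _ perm[OF that(1)] m p] by metis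
  qed
  have "cofactor_count ?T (\<beta> \<circ> transp p m) f
      = (\<Sum>a\<in>S - {f}. \<Sum>c\<in>?C. of_bool (\<beta> \<circ> transp p m \<circ> (transp m a \<circ> c) \<in> long_cycles ?T))"
    using fin ne m' unfolding cofactor_count_conv_sum[OF finite.insertI[OF fin]]
    by (subst sum_long_cycles_by_image[where x = m]) (simp_all only: del finite_Diff finite_insert not_False_eq_True)
  also have "\<dots> = (\<Sum>a\<in>S - {f} - {p}. \<Sum>c\<in>?C. of_bool (\<beta> \<circ> transp p m \<circ> (transp m a \<circ> c) \<in> long_cycles ?T))"
    using fin assms p same by (subst sum.remove[of _ p]) (auto simp: sum.neutral)
  also have "\<dots> = (\<Sum>a\<in>S - {f} - {p}. cofactor_count S (\<beta> \<circ> transp p a) f)"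
    unfolding cofactor_count_conv_sum[OF fin] by (intro sum.cong refl) (use other in auto)
  also have "S - {f} - {p} = S - {f, p}" by auto
  finally show ?thesis .
qed

text \<open>
  The recursion behind the uniformity on odd permutations. The cofactors missing \<open>m\<close> and those
  missing \<open>p\<close> are both as many as the full cycles \<open>d\<close> with \<open>\<beta> \<circ> d\<close> a full cycle. Counting the
  former by \<open>d p\<close> and the latter by the preimage of \<open>p\<close> supplies exactly the terms \<open>f = p\<close> and
  \<open>f = a\<close> of the right-hand side; the remaining terms match one by one.
\<close>

lemma sum_cofactor_count_insert:
  assumes "S - {p} \<noteq> {}"
  shows "(\<Sum>f\<in>insert m S. cofactor_count (insert m S) (\<beta> \<circ> transp p m) f)
     = (\<Sum>a\<in>S - {p}. \<Sum>f\<in>S. cofactor_count S (\<beta> \<circ> transp p a) f)"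
proof -
  let ?B = "card {d \<in> long_cycles S. \<beta> \<circ> d \<in> long_cycles S}"
  let ?N = "\<lambda>a f. cofactor_count S (\<beta> \<circ> transp p a) f"
  have "(\<Sum>f\<in>insert m S. cofactor_count (insert m S) (\<beta> \<circ> transp p m) f)
      = ?B + (?B + (\<Sum>f\<in>S - {p}. \<Sum>a\<in>S - {f, p}. ?N a f))"
    using fin m p
    by (simp add: sum.remove[of S p] cofactor_count_insert_at_new
        cofactor_count_insert_at_preimage cofactor_count_insert_elsewhere)
  also have "(\<Sum>f\<in>S - {p}. \<Sum>a\<in>S - {f, p}. ?N a f) = (\<Sum>a\<in>S - {p}. \<Sum>f\<in>S - {p, a}. ?N a f)"
  proof -
    have "(\<Sum>f\<in>S - {p}. \<Sum>a\<in>S - {f, p}. ?N a f)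
        = (\<Sum>f\<in>S - {p}. \<Sum>a\<in>{a. a \<in> S - {p} \<and> a \<noteq> f}. ?N a f)"
      by (intro sum.cong refl) auto
    also have "\<dots> = (\<Sum>a\<in>S - {p}. \<Sum>f\<in>{f. f \<in> S - {p} \<and> a \<noteq> f}. ?N a f)"
      using fin by (intro sum.swap_restrict) auto
    also have "\<dots> = (\<Sum>a\<in>S - {p}. \<Sum>f\<in>S - {p, a}. ?N a f)"
      by (intro sum.cong refl) auto
    finally show ?thesis .
  qed
  also have "?B + (?B + (\<Sum>a\<in>S - {p}. \<Sum>f\<in>S - {p, a}. ?N a f))
      = (\<Sum>a\<in>S - {p}. ?N a p + (?N a a + (\<Sum>f\<in>S - {p, a}. ?N a f)))"
    using card_equal_size_cofactors[OF fin p assms, of \<beta>] by (simp add: sum.distrib)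
  also have "\<dots> = (\<Sum>a\<in>S - {p}. \<Sum>f\<in>S. ?N a f)"
  proof (intro sum.cong refl)
    fix a assume a: "a \<in> S - {p}"
    have "S - {p, a} = S - {p} - {a}" by auto
    then show "?N a p + (?N a a + (\<Sum>f\<in>S - {p, a}. ?N a f)) = (\<Sum>f\<in>S. ?N a f)"
      using fin p a by (simp add: sum.remove[of S p] sum.remove[of "S - {p}" a])
  qed
  finally show ?thesis .
qed

lemma sum_cofactor_count_insert_singleton:
  assumes "S = {p}"
  shows "(\<Sum>f\<in>insert m S. cofactor_count (insert m S) (\<beta> \<circ> transp p m) f) = 2"
proof -
  have "\<beta> = id" using \<beta> assms by simp
  then have "{d \<in> long_cycles S. \<beta> \<circ> d \<in> long_cycles S} = {id}"
    using assms by (auto simp: long_cycles_singleton)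
  then have "cofactor_count (insert m S) (\<beta> \<circ> transp p m) m = 1"
    and "cofactor_count (insert m S) (\<beta> \<circ> transp p m) p = 1"
    using cofactor_count_insert_at_new cofactor_count_insert_at_preimage by simp_all
  moreover have "m \<noteq> p" using m p by auto
  ultimately show ?thesis using assms by simp
qed

end

text \<open>
  The number of factorizations does not depend on the odd permutation. An odd permutation moves some
  point \<open>m\<close>, so the recursion applies; \<open>\<beta>\<close> is even, hence all \<open>\<beta> \<circ> transp p a\<close> are odd permutations
  of one point less, and there are \<open>card T - 2\<close> choices of \<open>a\<close>.
\<close>

lemma sum_cofactor_count_odd:
  assumes "finite T" "\<alpha> permutes T" "\<not> evenperm \<alpha>"
  shows "(\<Sum>f\<in>T. cofactor_count T \<alpha> f) = 2 * fact (card T - 2)"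
  using assms
proof (induction "card T" arbitrary: T \<alpha> rule: less_induct)
  case less
  have "\<alpha> \<noteq> id" using less.prems by auto
  then obtain m where m: "\<alpha> m \<noteq> m" by (auto simp: fun_eq_iff)
  then have mT: "m \<in> T" using less.prems permutes_not_in by metis
  define p where "p = inv' \<alpha> m"
  have p: "\<alpha> p = m" using less.prems by (simp add: p_def permutes_inverses)
  then have pm: "p \<noteq> m" using m by auto
  have pT: "p \<in> T" using p mT permutes_in_image[OF less.prems(2)] by metis
  define S where "S = T - {m}"
  define \<beta> where "\<beta> = \<alpha> \<circ> transp p m"
  have T: "T = insert m S" using mT by (auto simp: S_def)
  have S: "finite S" "m \<notin> S" "p \<in> S" using less.prems pT pm by (auto simp: S_def)
  have "\<beta> permutes T"
    unfolding \<beta>_def using less.prems pT mT by (intro permutes_compose permutes_swap_id)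
  moreover have "\<beta> m = m" using p by (simp add: \<beta>_def)
  ultimately have \<beta>: "\<beta> permutes S"
    by (rule_tac permutes_superset) (auto simp: S_def)
  have \<alpha>: "\<alpha> = \<beta> \<circ> transp p m" by (simp add: \<beta>_def fun_eq_iff)
  have "permutation \<alpha>" using less.prems permutation_permutes by blast
  then have even: "evenperm \<beta>"
    using less.prems(3) pm by (simp add: \<beta>_def evenperm_comp permutation_swap_id evenperm_swap)
  show ?case
  proof (cases "S - {p} = {}")
    case True
    then have "S = {p}" using S by auto
    then show ?thesis
      using sum_cofactor_count_insert_singleton[OF S \<beta>] pm by (simp add: T \<alpha>)
  next
    case False
    then obtain n where n: "card S = Suc (Suc n)"
      using S by (metis card_Suc_Diff1 card_eq_0_iff finite_Diff not0_implies_Suc)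
    have "(\<Sum>f\<in>S. cofactor_count S (\<beta> \<circ> transp p a) f) = 2 * fact n" if "a \<in> S - {p}" for a
    proof -
      have "\<beta> \<circ> transp p a permutes S"
        using that S by (intro permutes_compose[OF _ \<beta>] permutes_swap_id) auto
      moreover have "\<not> evenperm (\<beta> \<circ> transp p a)"
        using that even \<beta> S(1) permutes_imp_permutation[OF S(1) \<beta>]
        by (auto simp: evenperm_comp permutation_swap_id evenperm_swap)
      ultimately show ?thesis
        using less.hyps[of S "\<beta> \<circ> transp p a"] S n T by simp
    qed
    then have "(\<Sum>f\<in>T. cofactor_count T \<alpha> f) = card (S - {p}) * (2 * fact n)"
      using sum_cofactor_count_insert[OF S \<beta> False] by (simp add: T \<alpha>)
    also have "\<dots> = 2 * fact (card T - 2)"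
      using S n T by simp
    finally show ?thesis .
  qed
qed

section \<open>Random quotients of long cycles\<close>

lemma bij_betw_conjugate_long_cycles:
  assumes "bij t"
  shows "bij_betw (\<lambda>p. t \<circ> p \<circ> inv' t) (long_cycles S) (long_cycles (t ` S))"
proof (rule bij_betw_byWitness[where f' = "\<lambda>p. inv' t \<circ> p \<circ> t"])
  have "inv' t (t x) = x" "t (inv' t y) = y" for x y
    using assms by (simp_all add: bij_is_inj bij_is_surj surj_f_inv_f)
  then show "\<forall>p\<in>long_cycles S. inv' t \<circ> (t \<circ> p \<circ> inv' t) \<circ> t = p"
    and "\<forall>p\<in>long_cycles (t ` S). t \<circ> (inv' t \<circ> p \<circ> t) \<circ> inv' t = p"
    by (simp_all add: fun_eq_iff)
  show "(\<lambda>p. t \<circ> p \<circ> inv' t) ` long_cycles S \<subseteq> long_cycles (t ` S)"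
    using long_cycles_conjugate[OF assms] by blast
  have "inv' t ` t ` S = S"
    using assms by (simp add: bij_is_inj image_inv_f_f)
  then show "(\<lambda>p. inv' t \<circ> p \<circ> t) ` long_cycles (t ` S) \<subseteq> long_cycles S"
    using long_cycles_conjugate[OF bij_imp_bij_inv[OF assms], where S = "t ` S"] inv_inv_eq[OF assms]
    by auto
qed

lemma sum_long_cycles_conjugate:
  assumes "bij t"
  shows "(\<Sum>p\<in>long_cycles (t ` S). g p) = (\<Sum>p\<in>long_cycles S. g (t \<circ> p \<circ> inv' t))"
  by (rule sum.reindex_bij_betw[OF bij_betw_conjugate_long_cycles[OF assms], symmetric])

lemma conjugate_comp_inv:
  assumes "bij t" "bij q"
  shows "(t \<circ> p \<circ> inv' t) \<circ> inv' (t \<circ> q \<circ> inv' t) = t \<circ> (p \<circ> inv' q) \<circ> inv' t"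
proof -
  have "inv' (t \<circ> q \<circ> inv' t) = t \<circ> inv' q \<circ> inv' t"
    using assms by (simp add: o_inv_distrib bij_comp bij_imp_bij_inv inv_inv_eq comp_assoc)
  then show ?thesis
    using assms by (simp add: fun_eq_iff bij_is_inj)
qed

text \<open>
  By induction, deleting the same point \<open>x\<close> from both cycles. If \<open>k\<close> conjugates the shortened cycle
  \<open>c\<close> into \<open>d\<close>, so does \<open>k\<close> followed by any power of \<open>d\<close>. Some power carries the image of the
  successor \<open>y\<close> of \<open>x\<close> to the successor \<open>z\<close> required by \<open>q\<close>, because \<open>d\<close> has a single orbit.
\<close>

lemma long_cycles_are_conjugate:
  assumes "finite S" "p \<in> long_cycles S" "q \<in> long_cycles S"
  shows "\<exists>k. k permutes S \<and> q = k \<circ> p \<circ> inv' k"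
proof -
  have "S \<noteq> {}" using assms by (auto simp: long_cycles_def num_cycles_def)
  with assms(1) have "\<exists>k. k permutes S \<and> k \<circ> p = q \<circ> k" using assms(2,3)
  proof (induction S arbitrary: p q rule: finite_ne_induct)
    case (singleton x)
    then show ?case by (auto simp: long_cycles_singleton)
  next
    case (insert x S)
    have del: "insert x S - {x} = S" using insert.hyps by auto
    obtain y c where y: "y \<in> S" "c \<in> long_cycles S" "p = transp x y \<circ> c"
      using long_cycle_deleteE[OF _ insert.prems(1), of x] insert.hyps unfolding del by auto
    obtain z d where z: "z \<in> S" "d \<in> long_cycles S" "q = transp x z \<circ> d"
      using long_cycle_deleteE[OF _ insert.prems(2), of x] insert.hyps unfolding del by auto
    obtain k where k: "k permutes S" "k \<circ> c = d \<circ> k"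
      using insert.IH[OF y(2) z(2)] by blast
    have "k y \<in> S" using permutes_in_image[OF k(1)] y(1) by simp
    then have "z \<in> orbit d (k y)"
      using orbit_long_cycle[OF insert(1) z(2)] z(1) by simp
    then obtain i where i: "(d ^^ i) (k y) = z" by (auto simp: orbit_altdef)
    \<comment> \<open>\<open>h\<close> fixes \<open>x\<close>, sends \<open>y\<close> to \<open>z\<close> and still conjugates \<open>c\<close> into \<open>d\<close>.\<close>
    define h where "h = (d ^^ i) \<circ> k"
    have "d permutes S" using z(2) by (simp add: long_cycles_def)
    then have "d ^^ i permutes S" by (rule permutes_funpow)
    then have hS: "h permutes S" unfolding h_def by (rule permutes_compose[OF k(1)])
    then have h: "h permutes insert x S" by (rule permutes_imp_permutes_insert)
    have hx: "h x = x" using hS insert.hyps(3) permutes_not_in by metis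
    have hy: "h y = z" using i by (simp add: h_def)
    have "(d ^^ i) ((d \<circ> k) v) = d ((d ^^ i) (k v))" for v
      by (simp add: funpow_swap1)
    then have "h \<circ> c = d \<circ> h"
      unfolding h_def k(2)[symmetric] by (simp add: fun_eq_iff)
    moreover have "h \<circ> transp x y = transp x z \<circ> h"
      using hx hy unfolding transpose_comp_eq[OF permutes_bij[OF hS]]
      by (simp add: permutes_inv_eq[OF hS, THEN iffD2])
    ultimately have "h \<circ> p = q \<circ> h"
      unfolding y(3) z(3) by (metis comp_assoc)
    with h show ?case by blast
  qed
  then obtain k where k: "k permutes S" "k \<circ> p = q \<circ> k" by blast
  then have "q = k \<circ> p \<circ> inv' k"
    using permutes_inv_o(1)[OF k(1)] by (metis comp_assoc comp_id)
  with k show ?thesis by blast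
qed

text \<open>
  A conjugate of \<open>\<tau>\<close> by a uniformly random permutation is a uniformly random long cycle. The left sum
  does not change when \<open>\<tau>\<close> is replaced by another long cycle; averaging over all of them and
  exchanging the sums makes the conjugation a mere reindexing.
\<close>

lemma sum_over_conjugates:
  fixes g :: "('a \<Rightarrow> 'a) \<Rightarrow> 'b::comm_semiring_1"
  assumes "finite S" "\<tau> \<in> long_cycles S"
  shows "of_nat (fact (card S - 1)) * (\<Sum>\<sigma> | \<sigma> permutes S. g (\<sigma> \<circ> \<tau> \<circ> inv' \<sigma>))
       = of_nat (fact (card S)) * (\<Sum>\<gamma>\<in>long_cycles S. g \<gamma>)"
proof -
  let ?P = "{\<sigma>. \<sigma> permutes S}"
  have "S \<noteq> {}" using assms by (auto simp: long_cycles_def num_cycles_def)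
  have "(\<Sum>\<sigma>\<in>?P. g (\<sigma> \<circ> \<gamma> \<circ> inv' \<sigma>)) = (\<Sum>\<sigma>\<in>?P. g (\<sigma> \<circ> \<tau> \<circ> inv' \<sigma>))"
    if \<gamma>: "\<gamma> \<in> long_cycles S" for \<gamma>
  proof -
    obtain k where k: "k permutes S" "\<gamma> = k \<circ> \<tau> \<circ> inv' k"
      using long_cycles_are_conjugate[OF assms \<gamma>] by blast
    have "\<sigma> \<circ> \<gamma> \<circ> inv' \<sigma> = (\<sigma> \<circ> k) \<circ> \<tau> \<circ> inv' (\<sigma> \<circ> k)" if "\<sigma> permutes S" for \<sigma>
      using that k by (simp add: o_inv_distrib permutes_bij comp_assoc)
    then show ?thesis
      by (subst sum_permutations_compose_right[OF k(1)]) simp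
  qed
  then have "of_nat (card (long_cycles S)) * (\<Sum>\<sigma>\<in>?P. g (\<sigma> \<circ> \<tau> \<circ> inv' \<sigma>))
      = (\<Sum>\<gamma>\<in>long_cycles S. \<Sum>\<sigma>\<in>?P. g (\<sigma> \<circ> \<gamma> \<circ> inv' \<sigma>))"
    by simp
  also have "\<dots> = (\<Sum>\<sigma>\<in>?P. \<Sum>\<gamma>\<in>long_cycles S. g (\<sigma> \<circ> \<gamma> \<circ> inv' \<sigma>))"
    by (rule sum.swap)
  also have "\<dots> = (\<Sum>\<sigma>\<in>?P. \<Sum>\<gamma>\<in>long_cycles S. g \<gamma>)"
  proof (rule sum.cong[OF refl])
    fix \<sigma> assume "\<sigma> \<in> ?P"
    then have "bij \<sigma>" "\<sigma> ` S = S" by (simp_all add: permutes_bij permutes_image)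
    then show "(\<Sum>\<gamma>\<in>long_cycles S. g (\<sigma> \<circ> \<gamma> \<circ> inv' \<sigma>)) = (\<Sum>\<gamma>\<in>long_cycles S. g \<gamma>)"
      using sum_long_cycles_conjugate[of \<sigma> g S] by simp
  qed
  also have "\<dots> = of_nat (fact (card S)) * (\<Sum>\<gamma>\<in>long_cycles S. g \<gamma>)"
    using card_permutations[OF refl assms(1)] by simp
  finally show ?thesis
    using card_long_cycles[OF assms(1) \<open>S \<noteq> {}\<close>] by simp
qed

text \<open>
  Throughout, \<open>w\<close> is an arbitrary weight on the number of cycles. Indicator weights give the
  distribution of this number, the weights \<open>t ^ k\<close> its generating polynomial.
\<close>

definition quotient_sum :: "(nat \<Rightarrow> 'b::comm_monoid_add) \<Rightarrow> 'a set \<Rightarrow> ('a \<Rightarrow> 'a) \<Rightarrow> 'b" where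
  "quotient_sum w S c = (\<Sum>d\<in>long_cycles S. w (num_cycles S (d \<circ> inv' c)))"

lemma quotient_sum_conjugate:
  assumes "bij t" "c \<in> long_cycles S"
  shows "quotient_sum w (t ` S) (t \<circ> c \<circ> inv' t) = quotient_sum w S c"
proof -
  have "bij c" using assms(2) permutes_bij by (auto simp: long_cycles_def)
  show ?thesis
    unfolding quotient_sum_def sum_long_cycles_conjugate[OF assms(1)]
      conjugate_comp_inv[OF assms(1) \<open>bij c\<close>] num_cycles_conjugate[OF assms(1)]
    by (rule refl)
qed

lemma quotient_sum_eq:
  assumes "finite S" "c \<in> long_cycles S" "d \<in> long_cycles S"
  shows "quotient_sum w S c = quotient_sum w S d"
proof -
  obtain k where k: "k permutes S" "d = k \<circ> c \<circ> inv' k"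
    using long_cycles_are_conjugate[OF assms] by blast
  show ?thesis
    using quotient_sum_conjugate[OF permutes_bij[OF k(1)] assms(2), where w = w]
    unfolding k(2) permutes_image[OF k(1)] by (rule sym)
qed

lemma sum_quotient_sum_image:
  assumes "bij t"
  shows "(\<Sum>c\<in>long_cycles (t ` S). quotient_sum w (t ` S) c)
       = (\<Sum>c\<in>long_cycles S. quotient_sum w S c)"
  unfolding sum_long_cycles_conjugate[OF assms]
  by (intro sum.cong refl quotient_sum_conjugate assms)

text \<open>
  Lengthening one of the two cycles by a new point leaves the number of cycles of the quotient
  unchanged, and there are \<open>card S\<close> places to insert the point.
\<close>

lemma sum_quotient_insert:
  fixes w :: "nat \<Rightarrow> 'b::comm_semiring_1"
  assumes "finite S" "f \<notin> S" "c \<in> long_cycles S"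
  shows "(\<Sum>d\<in>long_cycles (insert f S). w (num_cycles (insert f S) (d \<circ> inv' c)))
       = of_nat (card S) * quotient_sum w S c"
proof -
  have "S \<noteq> {}" using assms by (auto simp: long_cycles_def num_cycles_def)
  have c: "inv' c permutes S"
    using assms(3) permutes_inv by (auto simp: long_cycles_def)
  have del: "insert f S - {f} = S" using assms(2) by auto
  have "(\<Sum>d\<in>long_cycles (insert f S). w (num_cycles (insert f S) (d \<circ> inv' c)))
      = (\<Sum>a\<in>S. \<Sum>d\<in>long_cycles S. w (num_cycles (insert f S) (transp f a \<circ> d \<circ> inv' c)))"
    using assms(1) \<open>S \<noteq> {}\<close> sum_long_cycles_by_image[of "insert f S" f
      "\<lambda>d. w (num_cycles (insert f S) (d \<circ> inv' c))"] unfolding del by simp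
  also have "\<dots> = (\<Sum>a\<in>S. quotient_sum w S c)"
    unfolding quotient_sum_def
  proof (intro sum.cong refl)
    fix a d assume a: "a \<in> S" and "d \<in> long_cycles S"
    then have "d \<circ> inv' c permutes S"
      using permutes_compose[OF c] by (simp add: long_cycles_def)
    from num_cycles_insert_transp[OF assms(1) permutes_id this assms(2) a]
    show "w (num_cycles (insert f S) (transp f a \<circ> d \<circ> inv' c)) = w (num_cycles S (d \<circ> inv' c))"
      by (simp add: transpose_commute comp_assoc)
  qed
  finally show ?thesis by simp
qed

text \<open>
  The substitution \<open>d = \<alpha> \<circ> c\<close>. Cycles of consecutive lengths have opposite signs, so every quotient
  \<open>d \<circ> inv' c\<close> is odd.
\<close>

lemma sum_odd_comp_long_cycle:
  assumes "finite T" "f \<in> T" "c \<in> long_cycles (T - {f})"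
  shows "(\<Sum>\<alpha> | \<alpha> permutes T \<and> \<not> evenperm \<alpha> \<and> \<alpha> \<circ> c \<in> long_cycles T. g \<alpha>)
       = (\<Sum>d\<in>long_cycles T. g (d \<circ> inv' c))"
proof (rule sum.reindex_bij_witness[where i = "\<lambda>d. d \<circ> inv' c" and j = "\<lambda>\<alpha>. \<alpha> \<circ> c"])
  have c: "c permutes T"
    using assms(3) permutes_subset[of c "T - {f}" T] by (auto simp: long_cycles_def)
  note inv_c = permutes_inv_o[OF c]
  show 1: "\<alpha> \<circ> c \<circ> inv' c = \<alpha>" for \<alpha> by (simp add: comp_assoc inv_c)
  show 2: "d \<circ> inv' c \<circ> c = d" for d by (simp add: comp_assoc inv_c)
  show "g (\<alpha> \<circ> c \<circ> inv' c) = g \<alpha>" for \<alpha> by (simp only: 1)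
  show "\<alpha> \<circ> c \<in> long_cycles T"
    if "\<alpha> \<in> {\<alpha>. \<alpha> permutes T \<and> \<not> evenperm \<alpha> \<and> \<alpha> \<circ> c \<in> long_cycles T}" for \<alpha>
    using that by simp
  show "d \<circ> inv' c \<in> {\<alpha>. \<alpha> permutes T \<and> \<not> evenperm \<alpha> \<and> \<alpha> \<circ> c \<in> long_cycles T}"
    if d: "d \<in> long_cycles T" for d
  proof -
    have dT: "d permutes T" using d by (simp add: long_cycles_def)
    have "evenperm d \<longleftrightarrow> \<not> evenperm c"
      using evenperm_long_cycle[OF assms(1) d] evenperm_long_cycle[OF _ assms(3)] assms(1,2)
        card_Suc_Diff1[OF assms(1,2)] by (metis even_Suc finite_Diff)
    moreover have "permutation d" "permutation c"
      using permutes_imp_permutation[OF assms(1)] c dT by auto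
    ultimately have "\<not> evenperm (d \<circ> inv' c)"
      by (simp add: evenperm_comp evenperm_inv permutation_inverse)
    moreover have "d \<circ> inv' c permutes T"
      by (rule permutes_compose[OF permutes_inv[OF c] dT])
    ultimately show ?thesis using d by (simp add: 2)
  qed
qed

text \<open>
  Count the triples \<open>(\<alpha>, f, c)\<close> with \<open>\<alpha>\<close> odd and \<open>c\<close> a cofactor of \<open>\<alpha>\<close> missing \<open>f\<close>, weighted by the
  number of cycles of \<open>\<alpha>\<close>. For fixed \<open>\<alpha>\<close> there are \<open>2 * fact (card T - 2)\<close> of them. For fixed \<open>f\<close>
  and \<open>c\<close> they are quotients of a cycle on \<open>T\<close> by a cycle on \<open>T - {f}\<close>, which reduce to quotients of
  two cycles on \<open>T - {f}\<close>; by relabelling, all \<open>f\<close> contribute the same.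
\<close>

lemma sum_odd_eq_sum_quotients:
  fixes w :: "nat \<Rightarrow> 'b::comm_semiring_1"
  assumes "finite S" "S \<noteq> {}" "m \<notin> S"
  defines "T \<equiv> insert m S"
  shows "of_nat (2 * fact (card S - 1)) * (\<Sum>\<alpha> | \<alpha> permutes T \<and> \<not> evenperm \<alpha>. w (num_cycles T \<alpha>))
       = of_nat (card T * card S) * (\<Sum>c\<in>long_cycles S. quotient_sum w S c)"
proof -
  let ?Odd = "{\<alpha>. \<alpha> permutes T \<and> \<not> evenperm \<alpha>}"
  let ?w = "\<lambda>\<alpha>. w (num_cycles T \<alpha>)"
  have T: "finite T" "card T = Suc (card S)" using assms by (auto simp: T_def)
  have finO: "finite ?Odd"
    by (rule finite_subset[OF _ finite_permutations[OF T(1)]]) auto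
  have "of_nat (2 * fact (card S - 1)) * (\<Sum>\<alpha>\<in>?Odd. ?w \<alpha>)
      = (\<Sum>\<alpha>\<in>?Odd. of_nat (\<Sum>f\<in>T. cofactor_count T \<alpha> f) * ?w \<alpha>)"
    unfolding sum_distrib_left
    using sum_cofactor_count_odd[OF T(1)] T(2) by (intro sum.cong refl) simp
  also have "\<dots> = (\<Sum>\<alpha>\<in>?Odd. \<Sum>f\<in>T. \<Sum>c\<in>long_cycles (T - {f}). if \<alpha> \<circ> c \<in> long_cycles T then ?w \<alpha> else 0)"
    unfolding cofactor_count_conv_sum[OF T(1)] of_nat_sum sum_distrib_right
    by (intro sum.cong refl) simp
  also have "\<dots> = (\<Sum>f\<in>T. \<Sum>\<alpha>\<in>?Odd. \<Sum>c\<in>long_cycles (T - {f}). if \<alpha> \<circ> c \<in> long_cycles T then ?w \<alpha> else 0)"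
    by (rule sum.swap)
  also have "\<dots> = (\<Sum>f\<in>T. \<Sum>c\<in>long_cycles (T - {f}). \<Sum>\<alpha>\<in>?Odd. if \<alpha> \<circ> c \<in> long_cycles T then ?w \<alpha> else 0)"
    by (intro sum.cong refl sum.swap)
  also have "\<dots> = (\<Sum>f\<in>T. \<Sum>c\<in>long_cycles (T - {f}). of_nat (card S) * quotient_sum w (T - {f}) c)"
  proof (intro sum.cong refl)
    fix f c assume f: "f \<in> T" and c: "c \<in> long_cycles (T - {f})"
    have "insert f (T - {f}) = T" "card (T - {f}) = card S" using f T by auto
    then have "(\<Sum>d\<in>long_cycles T. ?w (d \<circ> inv' c)) = of_nat (card S) * quotient_sum w (T - {f}) c"
      using sum_quotient_insert[of "T - {f}" f c w] c T(1) by simp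
    moreover have "(\<Sum>\<alpha>\<in>?Odd. if \<alpha> \<circ> c \<in> long_cycles T then ?w \<alpha> else 0)
        = (\<Sum>\<alpha> | \<alpha> permutes T \<and> \<not> evenperm \<alpha> \<and> \<alpha> \<circ> c \<in> long_cycles T. ?w \<alpha>)"
      using finO by (subst sum.inter_filter[symmetric]) (auto intro!: sum.cong)
    ultimately show "(\<Sum>\<alpha>\<in>?Odd. if \<alpha> \<circ> c \<in> long_cycles T then ?w \<alpha> else 0)
        = of_nat (card S) * quotient_sum w (T - {f}) c"
      using sum_odd_comp_long_cycle[OF T(1) f c, of ?w] by simp
  qed
  also have "\<dots> = (\<Sum>f\<in>T. of_nat (card S) * (\<Sum>c\<in>long_cycles S. quotient_sum w S c))"
  proof (intro sum.cong refl)
    fix f assume "f \<in> T"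
    then have "T - {f} = transp f m ` S"
      using assms(3) by (auto simp: T_def in_transpose_image_iff Transposition.transpose_def)
    then show "(\<Sum>c\<in>long_cycles (T - {f}). of_nat (card S) * quotient_sum w (T - {f}) c)
        = of_nat (card S) * (\<Sum>c\<in>long_cycles S. quotient_sum w S c)"
      using sum_quotient_sum_image[of "transp f m" w S] by (simp add: sum_distrib_left[symmetric])
  qed
  also have "\<dots> = of_nat (card T * card S) * (\<Sum>c\<in>long_cycles S. quotient_sum w S c)"
    by (simp add: mult.assoc)
  finally show ?thesis .
qed

text \<open>
  The commutator is the quotient of the random long cycle \<open>\<sigma> \<circ> \<tau> \<circ> inv' \<sigma>\<close> by the fixed long cycle
  \<open>\<tau>\<close>, and by conjugacy the choice of the fixed cycle does not influence the weighted sum.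
\<close>

lemma sum_commutators_eq_sum_odd:
  fixes w :: "nat \<Rightarrow> 'b::{idom,ring_char_0}"
  assumes "finite S" "\<tau> \<in> long_cycles S" "m \<notin> S"
  defines "T \<equiv> insert m S"
  shows "of_nat (card T) * (\<Sum>\<sigma> | \<sigma> permutes S. w (num_cycles S (\<sigma> \<circ> \<tau> \<circ> inv' \<sigma> \<circ> inv' \<tau>)))
       = 2 * (\<Sum>\<alpha> | \<alpha> permutes T \<and> \<not> evenperm \<alpha>. w (num_cycles T \<alpha>))"
proof -
  let ?C = "\<Sum>\<sigma> | \<sigma> permutes S. w (num_cycles S (\<sigma> \<circ> \<tau> \<circ> inv' \<sigma> \<circ> inv' \<tau>))"
  let ?O = "\<Sum>\<alpha> | \<alpha> permutes T \<and> \<not> evenperm \<alpha>. w (num_cycles T \<alpha>)"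
  let ?q = "quotient_sum w S \<tau>"
  let ?F = "of_nat (fact (card S - 1)) :: 'b"
  have "S \<noteq> {}" using assms by (auto simp: long_cycles_def num_cycles_def)
  then have fact: "of_nat (fact (card S)) = of_nat (card S) * ?F"
    using assms(1) by (metis card_gt_0_iff fact_reduce of_nat_id of_nat_mult)
  have C: "?F * ?C = of_nat (fact (card S)) * ?q"
    unfolding quotient_sum_def
    by (rule sum_over_conjugates[OF assms(1,2), of "\<lambda>\<rho>. w (num_cycles S (\<rho> \<circ> inv' \<tau>))"])
  have "(\<Sum>c\<in>long_cycles S. quotient_sum w S c) = (\<Sum>c\<in>long_cycles S. ?q)"
    using quotient_sum_eq[OF assms(1) _ assms(2)] by (intro sum.cong refl)
  also have "\<dots> = ?F * ?q"
    using card_long_cycles[OF assms(1) \<open>S \<noteq> {}\<close>] by simp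
  finally have "?F * (2 * ?O) = of_nat (card T) * (of_nat (card S) * ?F * ?q)"
    using sum_odd_eq_sum_quotients[OF assms(1) \<open>S \<noteq> {}\<close> assms(3), of w]
    by (simp add: T_def mult_ac)
  also have "\<dots> = ?F * (of_nat (card T) * ?C)"
    using C unfolding fact by (simp add: mult_ac)
  finally show ?thesis by simp
qed

section \<open>Cycle generating functions and the distribution of the commutator\<close>

lemma cycle_of_list_long_cycle:
  assumes "distinct cs" "cs \<noteq> []"
  shows "cycle_of_list cs \<in> long_cycles (set cs)"
  using assms
proof (induction cs rule: cycle_of_list.induct)
  case (1 i j cs)
  have "id \<circ> transp j i \<circ> cycle_of_list (j # cs) \<in> long_cycles (insert i (set (j # cs)))"
    using 1 cycle_permutes[of "j # cs"]
    by (subst long_cycles_insert_transp_iff[where S = "set (j # cs)"]) auto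
  then show ?case by (simp add: transpose_commute comp_def)
qed (auto simp: long_cycles_singleton)

lemma commutator_sym_group:
  assumes "\<sigma> permutes {1..n}" "\<tau> permutes {1..n}"
  shows "commutator (sym_group n) \<sigma> \<tau> = \<sigma> \<circ> \<tau> \<circ> inv' \<sigma> \<circ> inv' \<tau>"
  using assms by (simp add: commutator_def sym_group_mult sym_group_carrier)

text \<open>
  A permutation of \<open>insert a S\<close> either fixes \<open>a\<close>, which adds one cycle, or arises from a permutation of
  \<open>S\<close> by inserting \<open>a\<close> at one of \<open>card S\<close> places, which keeps the number of cycles and flips the
  sign. The choices \<open>e = 1\<close> and \<open>e = - 1\<close> give the rising and the falling factorial.
\<close>

lemma cycle_generating_function:
  fixes x e :: "'b::comm_ring_1"
  assumes "finite S" "e * e = 1"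
  shows "(\<Sum>p | p permutes S. (if evenperm p then 1 else e) * x ^ num_cycles S p)
       = (\<Prod>i<card S. x + e * of_nat i)"
  using assms(1)
proof (induction S rule: finite_induct)
  case empty
  then show ?case by (simp add: num_cycles_def)
next
  case (insert a S)
  let ?h = "\<lambda>S p. (if evenperm p then 1 else e) * x ^ num_cycles S p"
  have fixed: "?h (insert a S) q = x * ?h S q" if "q permutes S" for q
    using num_cycles_insert_fixed[OF insert.hyps(1) that insert.hyps(2)] by (simp add: mult_ac)
  have moved: "?h (insert a S) (transp a b \<circ> q) = e * ?h S q" if "q permutes S" "b \<in> S" for q b
  proof -
    have "num_cycles (insert a S) (transp a b \<circ> q) = num_cycles S q"
      using num_cycles_insert_transp[OF insert.hyps(1) permutes_id that(1) insert.hyps(2) that(2)]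
      by (simp add: transpose_commute)
    moreover have "evenperm (transp a b \<circ> q) \<longleftrightarrow> \<not> evenperm q"
      using that insert.hyps permutes_imp_permutation[OF insert.hyps(1) that(1)]
      by (auto simp: evenperm_comp permutation_swap_id evenperm_swap)
    ultimately show ?thesis using assms(2) by (simp add: mult.assoc[symmetric])
  qed
  have "(\<Sum>p | p permutes insert a S. ?h (insert a S) p)
      = (\<Sum>q | q permutes S. ?h (insert a S) q)
        + (\<Sum>b\<in>S. \<Sum>q | q permutes S. ?h (insert a S) (transp a b \<circ> q))"
    unfolding sum_over_permutations_insert[OF insert.hyps] sum.insert[OF insert.hyps]
    by (simp only: transpose_same id_comp)
  also have "\<dots> = (\<Sum>q | q permutes S. x * ?h S q) + (\<Sum>b\<in>S. \<Sum>q | q permutes S. e * ?h S q)"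
    by (intro arg_cong2[where f = "(+)"] sum.cong refl fixed moved) simp_all
  also have "\<dots> = (\<Sum>q | q permutes S. ?h S q) * (x + e * of_nat (card S))"
    unfolding sum_distrib_left[symmetric] sum_constant by (simp only: algebra_simps)
  also have "\<dots> = (\<Prod>i<card (insert a S). x + e * of_nat i)"
    using insert by simp
  finally show ?case .
qed

lemma odd_cycle_generating_function:
  assumes "finite T"
  shows "2 * (\<Sum>\<alpha> | \<alpha> permutes T \<and> \<not> evenperm \<alpha>. [:0, 1:] ^ num_cycles T \<alpha>)
       = rising_fact_poly (card T) - falling_fact_poly (card T)"
proof -
  let ?X = "[:0, 1:] :: real poly"
  have "rising_fact_poly (card T) - falling_fact_poly (card T)
      = (\<Sum>\<alpha> | \<alpha> permutes T. (if evenperm \<alpha> then 1 else 1) * ?X ^ num_cycles T \<alpha>)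
      - (\<Sum>\<alpha> | \<alpha> permutes T. (if evenperm \<alpha> then 1 else - 1) * ?X ^ num_cycles T \<alpha>)"
    by (subst (1 2) cycle_generating_function[OF assms])
      (simp_all add: rising_fact_poly_def falling_fact_poly_def)
  also have "\<dots> = (\<Sum>\<alpha> | \<alpha> permutes T. if \<not> evenperm \<alpha> then 2 * ?X ^ num_cycles T \<alpha> else 0)"
    unfolding sum_subtractf[symmetric] by (intro sum.cong refl) simp
  also have "\<dots> = (\<Sum>\<alpha> | \<alpha> permutes T \<and> \<not> evenperm \<alpha>. 2 * ?X ^ num_cycles T \<alpha>)"
    using sum.inter_filter[OF finite_permutations[OF assms],
      of "\<lambda>\<alpha>. 2 * ?X ^ num_cycles T \<alpha>" "\<lambda>\<alpha>. \<not> evenperm \<alpha>"] by simp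
  finally show ?thesis by (simp add: sum_distrib_left)
qed

text \<open>
  Weighted sums that agree up to fixed factors determine the same distribution: the constant weight
  fixes the ratio of the cardinalities, and indicator weights then give the point masses.
\<close>

lemma map_pmf_of_set_eqI:
  assumes "finite A" "A \<noteq> {}" "finite B" "B \<noteq> {}" "a > 0" "b > 0"
    and sums: "\<And>w :: 'c \<Rightarrow> real. a * (\<Sum>x\<in>A. w (f x)) = b * (\<Sum>y\<in>B. w (g y))"
  shows "map_pmf f (pmf_of_set A) = map_pmf g (pmf_of_set B)"
proof (rule pmf_eqI)
  fix k :: 'c
  have total: "a * card A = b * card B"
    using sums[of "\<lambda>_. 1"] by simp
  have "a * card (A \<inter> f -` {k}) = b * card (B \<inter> g -` {k})"
    using sums[of "\<lambda>j. of_bool (j = k)"] assms(1,3)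
    by (simp add: of_bool_def sum.inter_filter[symmetric] Int_def vimage_def)
  then have "(a * card (A \<inter> f -` {k})) / (a * card A) = (b * card (B \<inter> g -` {k})) / (b * card B)"
    unfolding total by simp
  then show "pmf (map_pmf f (pmf_of_set A)) k = pmf (map_pmf g (pmf_of_set B)) k"
    using assms(1-6) by (simp add: pmf_map measure_pmf_of_set)
qed

theorem theorem2:
  fixes M :: nat and \<tau> :: "nat \<Rightarrow> nat"
  assumes "M \<ge> 1"
    and "\<tau> = cycle_of_list [1..<Suc M]"
  shows "(poly_expectation (pmf_of_set (carrier (sym_group M)))
           (\<lambda>\<sigma>. [:0, 1:] ^ num_cycles {1..M} (commutator (sym_group M) \<sigma> \<tau>))
         = smult (1 / fact (M + 1)) (rising_fact_poly (M + 1) - falling_fact_poly (M + 1)))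
       \<and> (map_pmf (\<lambda>\<sigma>. num_cycles {1..M} (commutator (sym_group M) \<sigma> \<tau>))
           (pmf_of_set (carrier (sym_group M)))
         = map_pmf (num_cycles {1..M + 1})
             (pmf_of_set (carrier (sym_group (M + 1)) - carrier (alt_group (M + 1)))))"
proof -
  let ?S = "{1..M}" and ?T = "{1..M + 1}"
  let ?P = "carrier (sym_group M)"
  let ?O = "carrier (sym_group (M + 1)) - carrier (alt_group (M + 1))"
  let ?C = "\<lambda>\<sigma>. num_cycles ?S (commutator (sym_group M) \<sigma> \<tau>)"
  have P: "?P = {\<sigma>. \<sigma> permutes ?S}"
    by (auto simp: sym_group_carrier)
  have O: "?O = {\<alpha>. \<alpha> permutes ?T \<and> \<not> evenperm \<alpha>}"
    by (auto simp: sym_group_carrier alt_group_carrier)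
  have T: "insert (M + 1) ?S = ?T" by auto
  have "set [1..<Suc M] = ?S" by auto
  then have \<tau>: "\<tau> \<in> long_cycles ?S"
    using cycle_of_list_long_cycle[of "[1..<Suc M]"] assms by simp
  then have \<tau>_perm: "\<tau> permutes ?S" by (simp add: long_cycles_def)
  have main: "of_nat (M + 1) * (\<Sum>\<sigma>\<in>?P. w (?C \<sigma>)) = 2 * (\<Sum>\<alpha>\<in>?O. w (num_cycles ?T \<alpha>))"
    for w :: "nat \<Rightarrow> 'b::{idom,ring_char_0}"
  proof -
    have "(\<Sum>\<sigma>\<in>?P. w (?C \<sigma>))
        = (\<Sum>\<sigma> | \<sigma> permutes ?S. w (num_cycles ?S (\<sigma> \<circ> \<tau> \<circ> inv' \<sigma> \<circ> inv' \<tau>)))"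
      unfolding P by (intro sum.cong refl) (simp only: mem_Collect_eq commutator_sym_group[OF _ \<tau>_perm])
    moreover have "card ?T = M + 1" by simp
    ultimately show ?thesis
      using sum_commutators_eq_sum_odd[OF _ \<tau>, of "M + 1" w] unfolding T O by simp
  qed
  have finP: "finite ?P" and cardP: "card ?P = fact M"
    using finite_permutations[of ?S] sym_group_card_carrier[of M] by (simp_all add: P)
  have neP: "?P \<noteq> {}" using cardP by fastforce
  have finO: "finite ?O"
    unfolding O by (rule finite_subset[OF _ finite_permutations[of ?T]]) auto
  have "transp 1 2 \<in> ?O"
    using assms(1) unfolding O by (auto simp: evenperm_swap intro: permutes_swap_id)
  then have neO: "?O \<noteq> {}" by blast
  have "real (M + 1) * (\<Sum>\<sigma>\<in>?P. w (?C \<sigma>)) = 2 * (\<Sum>\<alpha>\<in>?O. w (num_cycles ?T \<alpha>))"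
    for w :: "nat \<Rightarrow> real"
    by (rule main)
  then have "map_pmf ?C (pmf_of_set ?P) = map_pmf (num_cycles ?T) (pmf_of_set ?O)"
    by (intro map_pmf_of_set_eqI[OF finP neP finO neO, where a = "real (M + 1)" and b = 2]) simp_all
  moreover have "poly_expectation (pmf_of_set ?P) (\<lambda>\<sigma>. [:0, 1:] ^ ?C \<sigma>)
      = smult (1 / fact (M + 1)) (rising_fact_poly (M + 1) - falling_fact_poly (M + 1))"
  proof -
    have "poly_expectation (pmf_of_set ?P) (\<lambda>\<sigma>. [:0, 1:] ^ ?C \<sigma>)
        = smult (1 / fact M) (\<Sum>\<sigma>\<in>?P. [:0, 1:] ^ ?C \<sigma>)"
      using sum_comp_morphism[of "smult (1 / fact M)" "\<lambda>\<sigma>. [:0, 1:] ^ ?C \<sigma>" ?P]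
      by (simp add: poly_expectation_def finP neP cardP smult_add_right comp_def)
    also have "\<dots> = smult (1 / fact (M + 1)) (of_nat (M + 1) * (\<Sum>\<sigma>\<in>?P. [:0, 1:] ^ ?C \<sigma>))"
      by (simp add: of_nat_poly del: of_nat_Suc)
    also have "of_nat (M + 1) * (\<Sum>\<sigma>\<in>?P. [:0, 1:] ^ ?C \<sigma>)
        = rising_fact_poly (M + 1) - falling_fact_poly (M + 1)"
      using main[of "\<lambda>k. [:0, 1:] ^ k :: real poly"] odd_cycle_generating_function[of ?T]
      unfolding O by simp
    finally show ?thesis .
  qed
  ultimately show ?thesis by blast
qed

end
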